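(* Let $\mathcal{X}=\{x_1,\dots,x_M\}$ be a finite set of points of a Euclidean space, $\mathcal{Y}=\{y_1,\dots,y_N\}$ a finite set, $W(y|x)$ a channel transition law from $\mathcal{X}$ to $\mathcal{Y}$, $q:\mathcal{X}\times\mathcal{Y}\to(0,\infty)$ a decoding metric, and $\Gamma$ an average power bound. Write $s_{ij}=W(y_j|x_i)$ and $d_{ij}=-\log q(x_i,y_j)$. Then the optimized LM rate under the average power constraint, $$C_{\mathrm{LM}}=\max\Big\{I_{\mathrm{LM}}(Q_X): Q_X \text{ a probability distribution on }\mathcal{X},\ \sum_{i=1}^M Q_X(x_i)\|x_i\|^2\le\Gamma\Big\},$$ equals the optimal value of the maximization problem $$ \begin{aligned} \max_{p,\phi,\widetilde\psi,\ \zeta\ge 0}\quad & -\sum_{i=1}^M p_i\log p_i+\sum_{i=1}^M p_i\log T_i(\phi,\widetilde\psi,\zeta)+1\\ \text{s.t.}\quad & \sum_{i=1}^M p_i=1,\qquad \sum_{i=1}^M p_i\|x_i\|^2\le\Gamma, \end{aligned} $$ where $p\in\mathbb{R}^M$ has nonnegative entries, $\phi\in\mathbb{R}^M$ and $\widetilde\psi\in\mathbb{R}^N$ have positive entries, $\zeta\ge 0$ is real, and $$ T_i(\phi,\widetilde\psi,\zeta)=\phi_i\exp\Bigg(\sum_{j=1}^N s_{ij}\Big[-\sum_{k=1}^M\phi_k e^{-\zeta d_{kj}}\widetilde\psi_j+\log\widetilde\psi_j-\zeta d_{ij}\Big]\Bigg). $$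
   Context: $\log$ is the natural logarithm, $0\log 0=0$, mutual information is measured in nats, and "max" denotes optimal value (supremum). A channel transition law $W$ satisfies $W(y|x)\ge 0$ and $\sum_y W(y|x)=1$ for each $x$. Given a probability distribution $Q_X$ on $\mathcal{X}$, let $P_{XY}(x,y)=W(y|x)Q_X(x)$ and let $P_Y$ be its $\mathcal{Y}$-marginal. The LM rate is $$I_{\mathrm{LM}}(Q_X)=\min_{\widetilde P_{XY}} I_{\widetilde P}(X;Y),$$ where the minimum is over all probability distributions $\widetilde P_{XY}$ on $\mathcal{X}\times\mathcal{Y}$ with marginals $\widetilde P_X=Q_X$, $\widetilde P_Y=P_Y$ and satisfying $\mathbb{E}_{\widetilde P}[\log q(X,Y)]\ge\mathbb{E}_P[\log q(X,Y)]$, and $I_{\widetilde P}(X;Y)$ is the mutual information under $\widetilde P_{XY}$. *)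

theory Defs
  imports "HOL-Analysis.Analysis" "HOL-Probability.Probability"
begin

definition prob_dist :: "'c set \<Rightarrow> ('c \<Rightarrow> real) \<Rightarrow> bool" where
  "prob_dist A Q \<longleftrightarrow> (\<forall>a\<in>A. 0 \<le> Q a) \<and> (\<Sum>a\<in>A. Q a) = 1"

(* W x y stands for W(y|x). *)
definition channel :: "'a set \<Rightarrow> 'b set \<Rightarrow> ('a \<Rightarrow> 'b \<Rightarrow> real) \<Rightarrow> bool" where
  "channel X Y W \<longleftrightarrow> (\<forall>x\<in>X. prob_dist Y (W x))"

definition joint_law :: "('a \<Rightarrow> 'b \<Rightarrow> real) \<Rightarrow> ('a \<Rightarrow> real) \<Rightarrow> 'a \<times> 'b \<Rightarrow> real" where
  "joint_law W Q = (\<lambda>(x, y). W x y * Q x)"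

definition marginal1 :: "'b set \<Rightarrow> ('a \<times> 'b \<Rightarrow> real) \<Rightarrow> 'a \<Rightarrow> real" where
  "marginal1 Y P x = (\<Sum>y\<in>Y. P (x, y))"

definition marginal2 :: "'a set \<Rightarrow> ('a \<times> 'b \<Rightarrow> real) \<Rightarrow> 'b \<Rightarrow> real" where
  "marginal2 X P y = (\<Sum>x\<in>X. P (x, y))"

definition expected_log_metric ::
    "'a set \<Rightarrow> 'b set \<Rightarrow> ('a \<Rightarrow> 'b \<Rightarrow> real) \<Rightarrow> ('a \<times> 'b \<Rightarrow> real) \<Rightarrow> real" where
  "expected_log_metric X Y q P = (\<Sum>(x, y)\<in>X \<times> Y. P (x, y) * ln (q x y))"

(* Base exp 1: information is measured in nats. The finite-sum form is mutual_info_eq_sum below. *)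
definition mutual_info :: "'a set \<Rightarrow> 'b set \<Rightarrow> ('a \<times> 'b \<Rightarrow> real) \<Rightarrow> real" where
  "mutual_info X Y P =
     prob_space.mutual_information (point_measure (X \<times> Y) (\<lambda>z. ennreal (P z))) (exp 1)
       (count_space X) (count_space Y) fst snd"

definition LM_feasible ::
    "'a set \<Rightarrow> 'b set \<Rightarrow> ('a \<Rightarrow> 'b \<Rightarrow> real) \<Rightarrow> ('a \<Rightarrow> 'b \<Rightarrow> real) \<Rightarrow> ('a \<Rightarrow> real)
       \<Rightarrow> ('a \<times> 'b \<Rightarrow> real) set" where
  "LM_feasible X Y W q Q =
     {P. prob_dist (X \<times> Y) P
         \<and> (\<forall>x\<in>X. marginal1 Y P x = Q x)
         \<and> (\<forall>y\<in>Y. marginal2 X P y = marginal2 X (joint_law W Q) y)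
         \<and> expected_log_metric X Y q P \<ge> expected_log_metric X Y q (joint_law W Q)}"

(* Optimal values are extended reals, so that the value of an infeasible maximization is
   minus infinity and no boundedness is presupposed. *)
definition LM_rate ::
    "'a set \<Rightarrow> 'b set \<Rightarrow> ('a \<Rightarrow> 'b \<Rightarrow> real) \<Rightarrow> ('a \<Rightarrow> 'b \<Rightarrow> real) \<Rightarrow> ('a \<Rightarrow> real) \<Rightarrow> ereal" where
  "LM_rate X Y W q Q = (INF P\<in>LM_feasible X Y W q Q. ereal (mutual_info X Y P))"

definition C_LM ::
    "'a::euclidean_space set \<Rightarrow> 'b set \<Rightarrow> ('a \<Rightarrow> 'b \<Rightarrow> real) \<Rightarrow> ('a \<Rightarrow> 'b \<Rightarrow> real) \<Rightarrow> real \<Rightarrow> ereal" where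
  "C_LM X Y W q \<Gamma> =
     (SUP Q\<in>{Q. prob_dist X Q \<and> (\<Sum>x\<in>X. Q x * (norm x)\<^sup>2) \<le> \<Gamma>}. LM_rate X Y W q Q)"

definition T_fun ::
    "('m::finite \<Rightarrow> 'n::finite \<Rightarrow> real) \<Rightarrow> ('m \<Rightarrow> 'n \<Rightarrow> real)
       \<Rightarrow> real ^ 'm \<Rightarrow> real ^ 'n \<Rightarrow> real \<Rightarrow> 'm \<Rightarrow> real" where
  "T_fun s d \<phi> \<psi> \<zeta> i =
     \<phi> $ i * exp (\<Sum>j\<in>UNIV. s i j *
       (- (\<Sum>k\<in>UNIV. \<phi> $ k * exp (- \<zeta> * d k j) * \<psi> $ j) + ln (\<psi> $ j) - \<zeta> * d i j))"

definition program_objective ::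
    "('m::finite \<Rightarrow> 'n::finite \<Rightarrow> real) \<Rightarrow> ('m \<Rightarrow> 'n \<Rightarrow> real)
       \<Rightarrow> real ^ 'm \<Rightarrow> real ^ 'm \<Rightarrow> real ^ 'n \<Rightarrow> real \<Rightarrow> real" where
  "program_objective s d p \<phi> \<psi> \<zeta> =
     - (\<Sum>i\<in>UNIV. p $ i * ln (p $ i)) + (\<Sum>i\<in>UNIV. p $ i * ln (T_fun s d \<phi> \<psi> \<zeta> i)) + 1"

definition program_feasible ::
    "('m::finite \<Rightarrow> 'a::euclidean_space) \<Rightarrow> real
       \<Rightarrow> ((real ^ 'm) \<times> (real ^ 'm) \<times> (real ^ 'n::finite) \<times> real) set" where
  "program_feasible x \<Gamma> =
     {(p, \<phi>, \<psi>, \<zeta>). (\<forall>i. 0 \<le> p $ i) \<and> (\<forall>i. 0 < \<phi> $ i) \<and> (\<forall>j. 0 < \<psi> $ j) \<and> 0 \<le> \<zeta>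
        \<and> (\<Sum>i\<in>UNIV. p $ i) = 1 \<and> (\<Sum>i\<in>UNIV. p $ i * (norm (x i))\<^sup>2) \<le> \<Gamma>}"

lemma mutual_info_eq_sum:
  assumes "finite X" "finite Y" "prob_dist (X \<times> Y) P"
  shows "mutual_info X Y P =
    (\<Sum>(x, y)\<in>X \<times> Y. P (x, y) * ln (P (x, y) / (marginal1 Y P x * marginal2 X P y)))"
proof -
  define M where "M = point_measure (X \<times> Y) (\<lambda>z. ennreal (P z))"
  have fin: "finite (X \<times> Y)" and nn: "\<And>z. z \<in> X \<times> Y \<Longrightarrow> 0 \<le> P z"
    and s1: "(\<Sum>z\<in>X \<times> Y. P z) = 1"
    using assms by (auto simp: prob_dist_def)
  have ne: "X \<noteq> {}" "Y \<noteq> {}" using s1 by auto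
  have sp: "space M = X \<times> Y" and se: "sets M = Pow (X \<times> Y)"
    by (simp_all add: M_def space_point_measure sets_point_measure)
  have me: "measure M A = (\<Sum>z\<in>A. P z)" if "A \<subseteq> X \<times> Y" for A
  proof -
    have nnA: "\<And>z. z \<in> A \<Longrightarrow> 0 \<le> P z" using nn that by blast
    have "emeasure M A = (\<Sum>z\<in>A. ennreal (P z))"
      unfolding M_def by (rule emeasure_point_measure_finite[OF fin that])
    also have "\<dots> = ennreal (\<Sum>z\<in>A. P z)" using nnA by (rule sum_ennreal)
    finally show ?thesis using nnA by (simp add: measure_def sum_nonneg)
  qed
  have pm: "emeasure M (space M) = 1"
    unfolding sp unfolding M_def
    by (subst emeasure_point_measure_finite[OF fin order_refl])
       (simp add: sum_ennreal[OF nn] s1)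
  interpret M: prob_space M by standard (rule pm)
  interpret M: information_space M "exp 1" by standard simp
  have fX: "fst ` space M = X" and fY: "snd ` space M = Y"
    using ne by (auto simp: sp)
  have sf: "simple_function M f" for f :: "'a \<times> 'b \<Rightarrow> 'c"
    using fin unfolding simple_function_def sp se by auto
  define Px where "Px x = M.prob (fst -` {x} \<inter> space M)" for x
  define Py where "Py y = M.prob (snd -` {y} \<inter> space M)" for y
  define Pxy where "Pxy z = M.prob ((\<lambda>z. (fst z, snd z)) -` {z} \<inter> space M)" for z
  have dX: "simple_distributed M fst Px"
    by (rule M.simple_distributedI[OF sf]) (simp_all add: Px_def)
  have dY: "simple_distributed M snd Py"
    by (rule M.simple_distributedI[OF sf]) (simp_all add: Py_def)
  have dXY: "simple_distributed M (\<lambda>z. (fst z, snd z)) Pxy"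
    by (rule M.simple_distributedI[OF sf]) (simp_all add: Pxy_def)
  have eX: "Px x = marginal1 Y P x" if x: "x \<in> X" for x
  proof -
    have "fst -` {x} \<inter> space M = Pair x ` Y" using x by (auto simp: sp)
    moreover have "(\<Sum>z\<in>Pair x ` Y. P z) = marginal1 Y P x"
      by (subst sum.reindex) (auto simp: marginal1_def inj_on_def)
    moreover have "Pair x ` Y \<subseteq> X \<times> Y" using x by auto
    ultimately show ?thesis by (simp add: Px_def me)
  qed
  have eY: "Py y = marginal2 X P y" if y: "y \<in> Y" for y
  proof -
    have "snd -` {y} \<inter> space M = (\<lambda>x. (x, y)) ` X" using y by (auto simp: sp)
    moreover have "(\<Sum>z\<in>(\<lambda>x. (x, y)) ` X. P z) = marginal2 X P y"
      by (subst sum.reindex) (auto simp: marginal2_def inj_on_def)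
    moreover have "(\<lambda>x. (x, y)) ` X \<subseteq> X \<times> Y" using y by auto
    ultimately show ?thesis by (simp add: Py_def me)
  qed
  have eXY: "Pxy z = P z" if z: "z \<in> X \<times> Y" for z
  proof -
    have "(\<lambda>z. (fst z, snd z)) -` {z} \<inter> space M = {z}" using z by (auto simp: sp)
    then show ?thesis using z by (simp add: Pxy_def me)
  qed
  have "mutual_info X Y P = (\<Sum>(x, y)\<in>X \<times> Y. Pxy (x, y) * ln (Pxy (x, y) / (Px x * Py y)))"
    using M.mutual_information_simple_distributed[OF dX dY dXY]
    unfolding fX fY
    by (simp add: mutual_info_def M_def[symmetric] sp log_def)
  also have "\<dots> = (\<Sum>(x, y)\<in>X \<times> Y. P (x, y) * ln (P (x, y) / (marginal1 Y P x * marginal2 X P y)))"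
    by (intro sum.cong refl) (auto simp: eX eY eXY)
  finally show ?thesis .
qed

end

theory Submission
  imports Defs "HOL-Real_Asymp.Real_Asymp"
begin

text \<open>
  For a fixed input law \<open>p\<close> with output law \<open>r\<close>, the LM rate minimises the divergence of a coupling
  from \<open>p \<times> r\<close> under linear constraints, and the program's objective is its Lagrange dual: the
  multipliers \<open>a, b\<close> of the two marginals and \<open>\<zeta>\<close> of the metric constraint enter as
  \<open>\<phi>\<^sub>i = p\<^sub>i exp a\<^sub>i\<close> and \<open>\<psi>\<^sub>j = exp b\<^sub>j\<close>. Weak duality is the tangent inequality for \<open>t ln t\<close>.
  Strong duality holds without a Slater condition, at the price of a supremum that need not be
  attained. It follows from a quadratic penalty method: a minimiser of divergence plus
  \<open>N/2 \<cdot> (violation)\<^sup>2\<close> is stationary, hence of exponential form with multipliers \<open>N \<cdot> violation\<close>,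
  whose dual value is at least its divergence; as \<open>N\<close> grows, a subsequence converges to a feasible
  coupling.
\<close>

section \<open>The divergence summand: tangents, growth, continuity and stationarity\<close>

text \<open>Summand of the divergence of unnormalised measures. For \<open>q = 0\<close> it takes the junk value \<open>- t\<close>,
  so absolute continuity has to be carried along as a separate hypothesis.\<close>
definition gkl :: "real \<Rightarrow> real \<Rightarrow> real" where
  "gkl t q = t * ln (t / q) - t + q"

text \<open>This is the Fenchel-Young inequality: the conjugate of \<open>gkl\<close> in its first
  argument is \<open>q * exp u - q\<close>, and the tangent of slope \<open>u\<close> touches at
  \<open>t = q * exp u\<close>. It comes from \<open>ln z \<le> z - 1\<close> at
  \<open>z = q * exp u / t\<close>.\<close>

lemma gkl_ge_tangent:
  assumes "0 \<le> t" "0 < q"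
  shows "t * u - q * exp u + q \<le> gkl t q"
proof (cases "t = 0")
  case True
  then show ?thesis using assms by (simp add: gkl_def)
next
  case False
  then have t: "0 < t" using assms by simp
  have "ln (q * exp u / t) \<le> q * exp u / t - 1"
    using t assms by (intro ln_le_minus_one) simp
  moreover have "ln (q * exp u / t) = u - ln (t / q)"
    using t assms by (simp add: ln_div ln_mult)
  ultimately have "t * (u - ln (t / q)) \<le> t * (q * exp u / t - 1)"
    using t by (simp add: mult_left_mono)
  also have "\<dots> = q * exp u - t" using t by (simp add: field_simps)
  finally show ?thesis by (simp add: gkl_def algebra_simps)
qed

lemma gkl_nonneg:
  assumes "0 \<le> t" "0 \<le> q" "q = 0 \<Longrightarrow> t = 0"
  shows "0 \<le> gkl t q"
  using gkl_ge_tangent[of t q 0] assms by (cases "q = 0") (auto simp: gkl_def)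

text \<open>The tangent of slope 2 bounds \<open>2 * t\<close>, and one copy of \<open>t\<close> is
  then dropped. Strictness keeps minimisers off the upper faces of the box used below, so that they
  can be perturbed in both directions.\<close>

lemma gkl_sublevel_bound:
  assumes "0 \<le> t" "0 < q" "gkl t q \<le> c"
  shows "t < exp 2 * q + c + 1"
proof -
  have "t * 2 - q * exp 2 + q \<le> c"
    using gkl_ge_tangent[of t q 2] assms by simp
  then show ?thesis using assms by (simp add: algebra_simps)
qed

text \<open>Only the endpoint needs care: \<open>t * ln t\<close> is 0 at 0 whatever value
  \<open>ln 0\<close> has, and this agrees with the limit from the right.\<close>

lemma continuous_on_mult_ln: "continuous_on {0..} (\<lambda>t::real. t * ln t)"
  unfolding continuous_on_def
proof
  fix x :: real assume "x \<in> {0..}"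
  then consider "x = 0" | "0 < x" by force
  then show "((\<lambda>t. t * ln t) \<longlongrightarrow> x * ln x) (at x within {0..})"
  proof cases
    case 1
    have "((\<lambda>t::real. t * ln t) \<longlongrightarrow> 0) (at_right 0)" by real_asymp
    then show ?thesis using 1 by (simp add: at_within_Ici_at_right)
  next
    case 2
    then show ?thesis by (intro tendsto_intros) auto
  qed
qed

lemma continuous_on_gkl:
  assumes "0 \<le> q"
  shows "continuous_on {0..} (\<lambda>t. gkl t q)"
proof (cases "q = 0")
  case True
  then show ?thesis by (auto simp: gkl_def intro!: continuous_intros)
next
  case False
  have "continuous_on {0..} (\<lambda>t. t * ln t - t * ln q - t + q)"
    by (intro continuous_intros continuous_on_mult_ln)
  moreover have "gkl t q = t * ln t - t * ln q - t + q" if "t \<in> {0..}" for t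
    using that False assms by (cases "t = 0") (auto simp: gkl_def ln_div algebra_simps)
  ultimately show ?thesis by (subst continuous_on_cong[OF refl]) auto
qed

lemma continuous_on_sum_gkl:
  fixes Q :: "'i::finite \<Rightarrow> real"
  assumes "\<And>i. 0 \<le> Q i" "\<And>P i. P \<in> D \<Longrightarrow> 0 \<le> P $ i"
  shows "continuous_on D (\<lambda>P. \<Sum>i\<in>UNIV. gkl (P $ i) (Q i))"
  using assms
  by (intro continuous_on_sum continuous_on_compose2[OF continuous_on_gkl] continuous_intros) auto

text \<open>Minimality is only needed in the box \<open>[0, B]\<close>: a minimiser at \<open>p = 0\<close> is excluded by the infinite
  slope of \<open>t ln t\<close> there, so the stationarity equation holds.\<close>
lemma gkl_perturbed_minimum:
  assumes q: "0 < q" and p: "0 \<le> p" "p < B"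
    and le: "\<And>t. 0 \<le> p + t \<Longrightarrow> p + t \<le> B \<Longrightarrow> gkl p q \<le> gkl (p + t) q + g * t + C * t\<^sup>2"
  shows "p = q * exp (- g)"
proof -
  have "p \<noteq> 0"
  proof
    assume p0: "p = 0"
    \<comment> \<open>A step this small makes \<open>ln (t / q) + g + C * t\<close> nonpositive, so
      moving from 0 to \<open>t\<close> would strictly lower the perturbed objective. The bound 1
      serves \<open>C * t \<le> \<bar>C\<bar>\<close>, and \<open>B\<close> keeps the step inside
      the box.\<close>
    define t where "t = min B (min 1 (q * exp (- g - \<bar>C\<bar>)))"
    have t: "0 < t" "t \<le> B" "t \<le> 1" "t \<le> q * exp (- g - \<bar>C\<bar>)"
      using p p0 q by (auto simp: t_def)
    have "ln (t / q) \<le> ln (exp (- g - \<bar>C\<bar>))"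
      using t q by (subst ln_le_cancel_iff) (auto simp: field_simps)
    then have l: "ln (t / q) \<le> - g - \<bar>C\<bar>" by simp
    have "C * t \<le> \<bar>C\<bar> * 1"
      using t by (intro mult_mono) auto
    then have "t * (ln (t / q) - 1 + g + C * t) < 0"
      using l t by (intro mult_pos_neg) auto
    moreover have "0 \<le> t * (ln (t / q) - 1 + g + C * t)"
      using le[of t] t p0 by (simp add: gkl_def algebra_simps power2_eq_square)
    ultimately show False by simp
  qed
  then have p0: "0 < p" using p by simp
  define f where "f t = gkl (p + t) q + g * t + C * t\<^sup>2" for t
  have "(f has_real_derivative (ln (p / q) + g)) (at 0)"
    unfolding f_def gkl_def using p0 q
    by (auto intro!: derivative_eq_intros simp: field_simps)
  \<comment> \<open>Within this radius \<open>p + t\<close> stays in \<open>[0, B]\<close>, where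
    minimality is available.\<close>
  moreover have "0 < min p (B - p)" using p0 p by simp
  moreover have "\<forall>t. \<bar>0 - t\<bar> < min p (B - p) \<longrightarrow> f 0 \<le> f t"
    using le by (auto simp: f_def)
  ultimately have "ln (p / q) + g = 0" by (rule DERIV_local_min)
  then have "ln (p / q) = - g" by simp
  then have "p / q = exp (- g)" using p0 q by (metis divide_pos_pos exp_ln)
  then show ?thesis using q by (simp add: field_simps)
qed

section \<open>Quadratic penalty and strong duality for divergence minimisation under linear
  constraints\<close>

text \<open>The flag tells an equality constraint \<open>v = 0\<close> from an inequality constraint \<open>v \<le> 0\<close>.\<close>
definition residual :: "bool \<Rightarrow> real \<Rightarrow> real" where
  "residual e v = (if e then v else max 0 v)"

text \<open>A one-sided second-order expansion valid for both constraint types, which replaces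
  differentiating the penalty. It rests on the fact that taking the positive part before adding
  \<open>h\<close> can only enlarge the modulus.\<close>

lemma residual_add_sq_le: "(residual e (v + h))\<^sup>2 \<le> (residual e v)\<^sup>2 + 2 * residual e v * h + h\<^sup>2"
proof -
  have "\<bar>residual e (v + h)\<bar> \<le> \<bar>residual e v + h\<bar>"
    by (auto simp: residual_def max_def)
  then have "(residual e (v + h))\<^sup>2 \<le> (residual e v + h)\<^sup>2"
    by (simp only: abs_le_square_iff)
  then show ?thesis by (simp add: power2_sum)
qed

lemma sum_update:
  fixes f :: "'i::finite \<Rightarrow> real \<Rightarrow> real" and P :: "real ^ 'i"
  shows "(\<Sum>k\<in>UNIV. f k ((\<chi> k. if k = i then P $ i + t else P $ k) $ k))
    = (\<Sum>k\<in>UNIV. f k (P $ k)) + (f i (P $ i + t) - f i (P $ i))"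
proof -
  have "(\<Sum>k\<in>UNIV. f k ((\<chi> k. if k = i then P $ i + t else P $ k) $ k))
    = (\<Sum>k\<in>UNIV. f k (P $ k) + (if k = i then f i (P $ i + t) - f i (P $ i) else 0))"
    by (intro sum.cong) auto
  then show ?thesis by (simp add: sum.distrib)
qed

text \<open>The point \<open>P0\<close> has no penalty, so its divergence \<open>K\<close> bounds
  the minimum, and the sublevel bound then confines candidates to a compact box. The box is flat in
  the coordinates with \<open>Q i = 0\<close>, which builds in absolute continuity. In each other
  coordinate, stationarity gives the exponential form, with \<open>N * res P k\<close> as multiplier
  of constraint \<open>k\<close>.\<close>

lemma entropy_penalty_minimiser:
  fixes Q :: "'i::finite \<Rightarrow> real" and A :: "'k::finite \<Rightarrow> 'i \<Rightarrow> real" and c :: "'k \<Rightarrow> real"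
    and P0 :: "real ^ 'i"
  assumes Q: "\<And>i. 0 \<le> Q i" and N: "0 < N"
    and P0: "\<And>i. 0 \<le> P0 $ i" "\<And>i. Q i = 0 \<Longrightarrow> P0 $ i = 0"
    and feas: "\<And>k. residual (E k) ((\<Sum>i\<in>UNIV. A k i * P0 $ i) - c k) = 0"
    and K: "K = (\<Sum>i\<in>UNIV. gkl (P0 $ i) (Q i))"
  defines "res \<equiv> \<lambda>P k. residual (E k) ((\<Sum>i\<in>UNIV. A k i * P $ i) - c k)"
  obtains P :: "real ^ 'i" where
    "P \<in> cbox 0 (\<chi> i. if Q i = 0 then 0 else exp 2 * Q i + K + 1)"
    "(\<Sum>i\<in>UNIV. gkl (P $ i) (Q i)) + N / 2 * (\<Sum>k\<in>UNIV. (res P k)\<^sup>2) \<le> K"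
    "\<And>i. P $ i = Q i * exp (- (\<Sum>k\<in>UNIV. N * res P k * A k i))"
proof -
  define B where "B i = (if Q i = 0 then 0 else exp 2 * Q i + K + 1)" for i
  define D where "D = cbox 0 (\<chi> i. B i)"
  define G where "G P = (\<Sum>i\<in>UNIV. gkl (P $ i) (Q i)) + N / 2 * (\<Sum>k\<in>UNIV. (res P k)\<^sup>2)"
    for P :: "real ^ 'i"
  have mem: "P \<in> D \<longleftrightarrow> (\<forall>i. 0 \<le> P $ i \<and> P $ i \<le> B i)" for P
    by (simp add: D_def mem_box_cart)
  have Qpos: "0 < Q i" if "Q i \<noteq> 0" for i using Q[of i] that by simp
  have bound: "P $ i < B i"
    if "\<And>i. 0 \<le> P $ i" "\<And>i. Q i = 0 \<Longrightarrow> P $ i = 0" "G P \<le> K" "Q i \<noteq> 0" for P i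
  proof -
    have nn: "0 \<le> gkl (P $ j) (Q j)" for j using that Q by (intro gkl_nonneg)
    have "gkl (P $ i) (Q i) \<le> (\<Sum>j\<in>UNIV. gkl (P $ j) (Q j))"
      by (rule member_le_sum) (use nn in auto)
    also have "\<dots> \<le> G P" using N by (simp add: G_def sum_nonneg)
    finally show ?thesis
      using gkl_sublevel_bound[of "P $ i" "Q i" K] that Qpos[of i] by (simp add: B_def)
  qed
  have D0: "P $ i = 0" if "P \<in> D" "Q i = 0" for P i
  proof -
    have "0 \<le> P $ i \<and> P $ i \<le> B i" using that by (simp only: mem)
    then show ?thesis using that by (simp add: B_def)
  qed
  have GP0: "G P0 = K" by (simp add: G_def res_def feas K)
  have P0D: "P0 \<in> D" unfolding mem
  proof
    fix i show "0 \<le> P0 $ i \<and> P0 $ i \<le> B i"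
      using P0 bound[of P0 i] GP0 by (cases "Q i = 0") (auto simp: B_def less_imp_le)
  qed
  have "continuous_on D (\<lambda>P. residual (E k) ((\<Sum>i\<in>UNIV. A k i * P $ i) - c k))" for k
    unfolding residual_def by (cases "E k") (auto intro!: continuous_intros)
  then have "continuous_on D (\<lambda>P. N / 2 * (\<Sum>k\<in>UNIV. (res P k)\<^sup>2))"
    unfolding res_def by (intro continuous_intros)
  moreover have "continuous_on D (\<lambda>P. \<Sum>i\<in>UNIV. gkl (P $ i) (Q i))"
    using Q by (rule continuous_on_sum_gkl) (simp add: mem)
  ultimately have cont: "continuous_on D G"
    unfolding G_def by (rule continuous_on_add[rotated])
  have "compact D" by (simp add: D_def)
  then obtain P where P: "P \<in> D" and min: "\<And>P'. P' \<in> D \<Longrightarrow> G P \<le> G P'"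
    using continuous_attains_inf[of D G] cont P0D by blast
  have GPK: "G P \<le> K" using min[OF P0D] GP0 by simp
  have Pnn: "0 \<le> P $ i" for i using P by (simp add: mem)
  have P0': "P $ i = 0" if "Q i = 0" for i using P that by (rule D0)
  have stat: "P $ i = Q i * exp (- (\<Sum>k\<in>UNIV. N * res P k * A k i))" for i
  proof (cases "Q i = 0")
    case True
    then show ?thesis by (simp add: P0')
  next
    case False
    show ?thesis
    \<comment> \<open>Changing only coordinate \<open>i\<close> by \<open>t\<close> shifts
      constraint \<open>k\<close> by \<open>t * A k i\<close>. Expanding the penalty accordingly
      gives the slope \<open>g\<close> as the sum of \<open>N * res P k * A k i\<close>, and
      \<open>C\<close> as \<open>N / 2\<close> times the sum of the squares of
      \<open>A k i\<close>.\<close>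
    proof (rule gkl_perturbed_minimum[OF Qpos[OF False] Pnn bound])
      fix t assume t: "0 \<le> P $ i + t" "P $ i + t \<le> B i"
      define P' :: "real ^ 'i" where "P' = (\<chi> k. if k = i then P $ i + t else P $ k)"
      have "P' \<in> D" using P t by (auto simp: mem P'_def)
      then have "G P \<le> G P'" by (rule min)
      moreover have "(\<Sum>j\<in>UNIV. gkl (P' $ j) (Q j)) = (\<Sum>j\<in>UNIV. gkl (P $ j) (Q j))
          + (gkl (P $ i + t) (Q i) - gkl (P $ i) (Q i))"
        unfolding P'_def by (rule sum_update[where f = "\<lambda>j z. gkl z (Q j)"])
      moreover have "(res P' k)\<^sup>2 \<le> (res P k)\<^sup>2 + 2 * res P k * (t * A k i) + (t * A k i)\<^sup>2" for k
      proof -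
        have "(\<Sum>j\<in>UNIV. A k j * P' $ j) = (\<Sum>j\<in>UNIV. A k j * P $ j)
            + (A k i * (P $ i + t) - A k i * P $ i)"
          unfolding P'_def by (rule sum_update[where f = "\<lambda>j z. A k j * z"])
        then have "(\<Sum>j\<in>UNIV. A k j * P' $ j) - c k = ((\<Sum>j\<in>UNIV. A k j * P $ j) - c k) + t * A k i"
          by (simp add: algebra_simps)
        then show ?thesis by (simp only: res_def residual_add_sq_le)
      qed
      then have "N / 2 * (\<Sum>k\<in>UNIV. (res P' k)\<^sup>2)
          \<le> N / 2 * (\<Sum>k\<in>UNIV. (res P k)\<^sup>2 + 2 * res P k * (t * A k i) + (t * A k i)\<^sup>2)"
        using N by (intro mult_left_mono sum_mono) auto
      then have "N / 2 * (\<Sum>k\<in>UNIV. (res P' k)\<^sup>2)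
          \<le> N / 2 * (\<Sum>k\<in>UNIV. (res P k)\<^sup>2) + (\<Sum>k\<in>UNIV. N * res P k * A k i) * t
            + N / 2 * (\<Sum>k\<in>UNIV. (A k i)\<^sup>2) * t\<^sup>2"
        by (simp add: sum.distrib sum_distrib_left sum_distrib_right algebra_simps power_mult_distrib)
      ultimately show "gkl (P $ i) (Q i) \<le> gkl (P $ i + t) (Q i)
          + (\<Sum>k\<in>UNIV. N * res P k * A k i) * t + N / 2 * (\<Sum>k\<in>UNIV. (A k i)\<^sup>2) * t\<^sup>2"
        by (simp add: G_def)
    qed (use Pnn P0' GPK False in auto)
  qed
  show ?thesis
    using that[of P] P GPK stat by (simp add: D_def B_def G_def)
qed

text \<open>The last right-hand side is the Lagrange dual function, since
  \<open>gkl t q + \<lambda> * t\<close> has minimum \<open>q - q * exp (- \<lambda>)\<close>. The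
  multipliers of the penalty minimisers may diverge while the minimisers converge along a
  subsequence. Hence \<open>P\<close> is fixed once, but every \<open>e\<close> gets its own
  \<open>l\<close>.\<close>

lemma entropy_strong_duality:
  fixes Q :: "'i::finite \<Rightarrow> real" and A :: "'k::finite \<Rightarrow> 'i \<Rightarrow> real" and c :: "'k \<Rightarrow> real"
    and P0 :: "real ^ 'i"
  assumes Q: "\<And>i. 0 \<le> Q i"
    and P0: "\<And>i. 0 \<le> P0 $ i" "\<And>i. Q i = 0 \<Longrightarrow> P0 $ i = 0"
    and feas: "\<And>k. residual (E k) ((\<Sum>i\<in>UNIV. A k i * P0 $ i) - c k) = 0"
  obtains P :: "real ^ 'i" where
    "\<And>i. 0 \<le> P $ i" "\<And>i. Q i = 0 \<Longrightarrow> P $ i = 0"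
    "\<And>k. residual (E k) ((\<Sum>i\<in>UNIV. A k i * P $ i) - c k) = 0"
    "\<And>e. 0 < e \<Longrightarrow> \<exists>l. (\<forall>k. \<not> E k \<longrightarrow> 0 \<le> l k) \<and>
      (\<Sum>i\<in>UNIV. gkl (P $ i) (Q i)) - e
        \<le> (\<Sum>i\<in>UNIV. Q i - Q i * exp (- (\<Sum>k\<in>UNIV. l k * A k i))) - (\<Sum>k\<in>UNIV. l k * c k)"
proof -
  define K where "K = (\<Sum>i\<in>UNIV. gkl (P0 $ i) (Q i))"
  define v where "v P k = (\<Sum>i\<in>UNIV. A k i * P $ i) - c k" for P :: "real ^ 'i" and k
  define res where "res P k = residual (E k) (v P k)" for P k
  define D :: "(real ^ 'i) set" where
    "D = cbox 0 (\<chi> i. if Q i = 0 then 0 else exp 2 * Q i + K + 1)"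
  define H where "H P = (\<Sum>i\<in>UNIV. gkl (P $ i) (Q i))" for P :: "real ^ 'i"
  have "\<exists>P. P \<in> D \<and> H P + real (Suc n) / 2 * (\<Sum>k\<in>UNIV. (res P k)\<^sup>2) \<le> K
      \<and> (\<forall>i. P $ i = Q i * exp (- (\<Sum>k\<in>UNIV. real (Suc n) * res P k * A k i)))" for n
  proof -
    have "0 < real (Suc n)" by simp
    from entropy_penalty_minimiser[where E = E and A = A and c = c, OF Q this P0 feas K_def]
    obtain P where "P \<in> D" "H P + real (Suc n) / 2 * (\<Sum>k\<in>UNIV. (res P k)\<^sup>2) \<le> K"
      "\<And>i. P $ i = Q i * exp (- (\<Sum>k\<in>UNIV. real (Suc n) * res P k * A k i))"
      unfolding D_def H_def res_def v_def by blast
    then show ?thesis by blast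
  qed
  then have "\<exists>p. \<forall>n. p n \<in> D \<and> H (p n) + real (Suc n) / 2 * (\<Sum>k\<in>UNIV. (res (p n) k)\<^sup>2) \<le> K
      \<and> (\<forall>i. p n $ i = Q i * exp (- (\<Sum>k\<in>UNIV. real (Suc n) * res (p n) k * A k i)))"
    by (intro choice allI)
  then obtain p where pD: "p n \<in> D"
    and pK: "H (p n) + real (Suc n) / 2 * (\<Sum>k\<in>UNIV. (res (p n) k)\<^sup>2) \<le> K"
    and pexp: "p n $ i = Q i * exp (- (\<Sum>k\<in>UNIV. real (Suc n) * res (p n) k * A k i))" for n i
    by blast
  have D0: "0 \<le> P $ i" "Q i = 0 \<Longrightarrow> P $ i = 0" if "P \<in> D" for P i
    using that unfolding D_def mem_box_cart
    by (auto dest!: spec[of _ i])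
  have Hnn: "0 \<le> H P" if "P \<in> D" for P
    unfolding H_def using D0[OF that] Q by (intro sum_nonneg gkl_nonneg)
  have contH: "continuous_on D H"
    unfolding H_def using Q D0(1) by (rule continuous_on_sum_gkl)
  have contres: "continuous_on D (\<lambda>P. res P k)" for k
    unfolding res_def v_def residual_def by (cases "E k") (auto intro!: continuous_intros)
  \<comment> \<open>With multipliers \<open>l = N * res\<close> the gap between the dual value and \<open>H\<close> is \<open>\<Sum>k. l k * v k \<ge> 0\<close>.\<close>
  have dual: "H (p n) \<le> (\<Sum>i\<in>UNIV. Q i - Q i * exp (- (\<Sum>k\<in>UNIV. real (Suc n) * res (p n) k * A k i)))
      - (\<Sum>k\<in>UNIV. real (Suc n) * res (p n) k * c k)" for n
  proof -
    define l where "l k = real (Suc n) * res (p n) k" for k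
    have g: "gkl (p n $ i) (Q i) = Q i - p n $ i - (\<Sum>k\<in>UNIV. l k * A k i) * p n $ i" for i
    proof (cases "Q i = 0")
      case True
      then show ?thesis using D0(2)[OF pD] by (simp add: gkl_def)
    next
      case False
      have "p n $ i / Q i = exp (- (\<Sum>k\<in>UNIV. l k * A k i))"
        using False pexp[of n i] by (simp add: l_def)
      then show ?thesis by (simp add: gkl_def)
    qed
    have "0 \<le> l k * v (p n) k" for k
      by (auto simp: l_def res_def residual_def max_def mult.assoc)
    then have "0 \<le> (\<Sum>k\<in>UNIV. l k * v (p n) k)" by (intro sum_nonneg)
    also have "\<dots> = (\<Sum>k\<in>UNIV. \<Sum>i\<in>UNIV. l k * A k i * p n $ i) - (\<Sum>k\<in>UNIV. l k * c k)"
      by (simp add: v_def right_diff_distrib sum_subtractf sum_distrib_left mult.assoc)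
    also have "(\<Sum>k\<in>UNIV. \<Sum>i\<in>UNIV. l k * A k i * p n $ i)
        = (\<Sum>i\<in>UNIV. (\<Sum>k\<in>UNIV. l k * A k i) * p n $ i)"
      unfolding sum_distrib_right by (rule sum.swap)
    finally have "0 \<le> (\<Sum>i\<in>UNIV. (\<Sum>k\<in>UNIV. l k * A k i) * p n $ i) - (\<Sum>k\<in>UNIV. l k * c k)" .
    moreover have "H (p n) = (\<Sum>i\<in>UNIV. Q i - p n $ i) - (\<Sum>i\<in>UNIV. (\<Sum>k\<in>UNIV. l k * A k i) * p n $ i)"
      by (simp add: H_def g sum_subtractf)
    moreover have "(\<Sum>i\<in>UNIV. Q i - p n $ i) = (\<Sum>i\<in>UNIV. Q i - Q i * exp (- (\<Sum>k\<in>UNIV. l k * A k i)))"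
      by (simp only: l_def pexp[of n, symmetric])
    ultimately show ?thesis by (simp add: l_def)
  qed
  have "compact D" by (simp add: D_def)
  then obtain P r where P: "P \<in> D" and r: "strict_mono r" and lim: "(p \<circ> r) \<longlonglongrightarrow> P"
    using pD unfolding compact_def by metis
  have limc: "(\<lambda>n. f (p (r n))) \<longlonglongrightarrow> f P" if "continuous_on D f" for f :: "real ^ 'i \<Rightarrow> real"
    using continuous_on_tendsto_compose[OF that lim P] pD by simp
  have res0: "res P k = 0" for k
  proof -
    \<comment> \<open>The divergence is nonnegative, so the whole budget \<open>K\<close> bounds the
      penalty, and the residuals decay like the inverse square root of the penalty weight.\<close>
    have "(res (p n) k)\<^sup>2 \<le> 2 * K * inverse (real (Suc n))" for n
    proof -
      have "(res (p n) k)\<^sup>2 \<le> (\<Sum>k\<in>UNIV. (res (p n) k)\<^sup>2)" by (rule member_le_sum) auto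
      then have "real (Suc n) / 2 * (res (p n) k)\<^sup>2 \<le> real (Suc n) / 2 * (\<Sum>k\<in>UNIV. (res (p n) k)\<^sup>2)"
        by (intro mult_left_mono) auto
      also have "\<dots> \<le> K" using pK[of n] Hnn[OF pD[of n]] by simp
      finally show ?thesis by (simp add: field_simps)
    qed
    moreover have "(\<lambda>n. 2 * K * inverse (real (Suc n))) \<longlonglongrightarrow> 2 * K * 0"
      by (intro tendsto_intros LIMSEQ_inverse_real_of_nat)
    then have "((\<lambda>n. 2 * K * inverse (real (Suc n))) \<circ> r) \<longlonglongrightarrow> 2 * K * 0"
      using r by (rule LIMSEQ_subseq_LIMSEQ)
    moreover have "(\<lambda>n. (res (p (r n)) k)\<^sup>2) \<longlonglongrightarrow> (res P k)\<^sup>2"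
      by (intro tendsto_intros limc contres)
    ultimately have "(res P k)\<^sup>2 \<le> 2 * K * 0"
      by (intro LIMSEQ_le) (auto simp: comp_def)
    then show ?thesis by simp
  qed
  show ?thesis
  proof (rule that[of P])
    fix e :: real assume e: "0 < e"
    have "\<forall>\<^sub>F n in sequentially. H P - e < H (p (r n))"
      using limc[OF contH] e by (intro order_tendstoD(1)[of _ "H P"]) auto
    then obtain n where n: "H P - e < H (p (r n))"
      by (auto simp: eventually_sequentially)
    show "\<exists>l. (\<forall>k. \<not> E k \<longrightarrow> 0 \<le> l k) \<and>
      (\<Sum>i\<in>UNIV. gkl (P $ i) (Q i)) - e
        \<le> (\<Sum>i\<in>UNIV. Q i - Q i * exp (- (\<Sum>k\<in>UNIV. l k * A k i))) - (\<Sum>k\<in>UNIV. l k * c k)"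
    proof (intro exI[of _ "\<lambda>k. real (Suc (r n)) * res (p (r n)) k"] conjI allI impI)
      show "0 \<le> real (Suc (r n)) * res (p (r n)) k" if "\<not> E k" for k
        using that by (simp add: res_def residual_def)
    qed (use n dual[of "r n"] in \<open>simp add: H_def\<close>)
  qed (use P D0 res0 in \<open>auto simp: res_def v_def\<close>)
qed

section \<open>The program as Lagrange dual for a fixed input law\<close>

lemma sum_UNIV_sum:
  fixes f :: "'a::finite + 'b::finite \<Rightarrow> 'c::comm_monoid_add"
  shows "(\<Sum>k\<in>UNIV. f k) = (\<Sum>a\<in>UNIV. f (Inl a)) + (\<Sum>b\<in>UNIV. f (Inr b))"
  using sum.Plus[of "UNIV :: 'a set" "UNIV :: 'b set" f] by simp

lemma sum_UNIV_prod:
  fixes f :: "'a::finite \<times> 'b::finite \<Rightarrow> 'c::comm_monoid_add"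
  shows "(\<Sum>z\<in>UNIV. f z) = (\<Sum>a\<in>UNIV. \<Sum>b\<in>UNIV. f (a, b))"
  by (simp add: sum.cartesian_product)

text \<open>Taking the logarithm of \<open>T_fun\<close> and averaging with \<open>p\<close> turns
  the channel weights into the output law \<open>r\<close>, except in the metric term. What remains
  is a sum of one term per multiplier minus an exponential double sum, the shape of the dual
  function.\<close>

lemma program_objective_eq:
  fixes s d :: "'m::finite \<Rightarrow> 'n::finite \<Rightarrow> real" and p :: "real ^ 'm"
  assumes \<phi>: "\<And>i. 0 < \<phi> $ i"
  defines "r \<equiv> \<lambda>j. \<Sum>i\<in>UNIV. p $ i * s i j"
  shows "program_objective s d p \<phi> \<psi> \<zeta> =
    (\<Sum>i\<in>UNIV. p $ i * (ln (\<phi> $ i) - ln (p $ i))) + (\<Sum>j\<in>UNIV. r j * ln (\<psi> $ j))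
      - \<zeta> * (\<Sum>i\<in>UNIV. \<Sum>j\<in>UNIV. p $ i * s i j * d i j)
      - (\<Sum>i\<in>UNIV. \<Sum>j\<in>UNIV. \<phi> $ i * r j * \<psi> $ j * exp (- \<zeta> * d i j)) + 1"
proof -
  define S where "S j = (\<Sum>k\<in>UNIV. \<phi> $ k * exp (- \<zeta> * d k j) * \<psi> $ j)" for j
  have lnT: "p $ i * ln (T_fun s d \<phi> \<psi> \<zeta> i) = p $ i * ln (\<phi> $ i)
      + ((\<Sum>j\<in>UNIV. p $ i * s i j * ln (\<psi> $ j)) - (\<Sum>j\<in>UNIV. p $ i * s i j * S j)
        - \<zeta> * (\<Sum>j\<in>UNIV. p $ i * s i j * d i j))" for i
  proof -
    have "ln (T_fun s d \<phi> \<psi> \<zeta> i) = ln (\<phi> $ i)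
      + (\<Sum>j\<in>UNIV. s i j * (- S j + ln (\<psi> $ j) - \<zeta> * d i j))"
      using \<phi>[of i] by (simp add: T_fun_def S_def ln_mult)
    then show ?thesis
      by (simp add: distrib_left sum_distrib_left sum.distrib[symmetric] sum_subtractf[symmetric])
        (intro sum.cong refl, simp add: algebra_simps)
  qed
  have swap: "(\<Sum>i\<in>UNIV. \<Sum>j\<in>UNIV. p $ i * s i j * f j) = (\<Sum>j\<in>UNIV. r j * f j)" for f
    unfolding r_def sum_distrib_right by (rule sum.swap)
  have "(\<Sum>j\<in>UNIV. r j * S j)
      = (\<Sum>i\<in>UNIV. \<Sum>j\<in>UNIV. \<phi> $ i * r j * \<psi> $ j * exp (- \<zeta> * d i j))"
    unfolding S_def sum_distrib_left by (subst sum.swap) (simp add: mult_ac)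
  then show ?thesis
    unfolding program_objective_def lnT
    by (simp add: sum.distrib sum_subtractf swap sum_distrib_left[symmetric] right_diff_distrib)
qed

text \<open>Weak duality: the tangent inequality is summed over all pairs. The marginals of
  \<open>P\<close> evaluate the terms of \<open>\<phi>\<close> and \<open>\<psi>\<close>, the metric
  constraint and \<open>0 \<le> \<zeta>\<close> handle the remaining one, and the \<open>+ 1\<close>
  of the objective is the total mass of the product law.\<close>

lemma program_objective_le_gkl:
  fixes s d P :: "'m::finite \<Rightarrow> 'n::finite \<Rightarrow> real" and p :: "real ^ 'm"
  defines "r \<equiv> \<lambda>j. \<Sum>i\<in>UNIV. p $ i * s i j"
  assumes p1: "(\<Sum>i\<in>UNIV. p $ i) = 1"
    and P: "\<And>i j. 0 \<le> P i j" "\<And>i. (\<Sum>j\<in>UNIV. P i j) = p $ i" "\<And>j. (\<Sum>i\<in>UNIV. P i j) = r j"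
    and Pd: "(\<Sum>i\<in>UNIV. \<Sum>j\<in>UNIV. P i j * d i j) \<le> (\<Sum>i\<in>UNIV. \<Sum>j\<in>UNIV. p $ i * s i j * d i j)"
    and \<phi>: "\<And>i. 0 < \<phi> $ i" and \<psi>: "\<And>j. 0 < \<psi> $ j" and \<zeta>: "0 \<le> \<zeta>"
  shows "program_objective s d p \<phi> \<psi> \<zeta> \<le> (\<Sum>i\<in>UNIV. \<Sum>j\<in>UNIV. gkl (P i j) (p $ i * r j))"
proof -
  have p0: "0 \<le> p $ i" for i using sum_nonneg[of UNIV "P i"] P by simp
  have r0: "0 \<le> r j" for j using sum_nonneg[of UNIV "\<lambda>i. P i j"] P by simp
  have Pp: "P i j \<le> p $ i" for i j
    using member_le_sum[of j UNIV "P i"] P by simp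
  have Pr: "P i j \<le> r j" for i j
    using member_le_sum[of i UNIV "\<lambda>i. P i j"] P by simp
  \<comment> \<open>This slope is chosen so that \<open>p $ i * r j * exp (u i j)\<close> is exactly
    the summand of the exponential double sum.\<close>
  define u where "u i j = ln (\<phi> $ i) - ln (p $ i) + ln (\<psi> $ j) - \<zeta> * d i j" for i j
  have le: "P i j * u i j - \<phi> $ i * r j * \<psi> $ j * exp (- \<zeta> * d i j) + p $ i * r j \<le> gkl (P i j) (p $ i * r j)"
    for i j
  proof (cases "p $ i * r j = 0")
    case True
    then have "P i j = 0" using Pp[of i j] Pr[of i j] P(1)[of i j] by auto
    then show ?thesis using True \<phi>[of i] \<psi>[of j] r0[of j] by (simp add: gkl_def)
  next
    case False
    then have pr: "0 < p $ i" "0 < r j" using p0[of i] r0[of j] by auto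
    have "p $ i * r j * exp (u i j) = \<phi> $ i * r j * \<psi> $ j * exp (- \<zeta> * d i j)"
      using pr \<phi>[of i] \<psi>[of j] by (simp add: u_def exp_add exp_diff exp_minus field_simps)
    moreover have "P i j * u i j - p $ i * r j * exp (u i j) + p $ i * r j \<le> gkl (P i j) (p $ i * r j)"
      by (rule gkl_ge_tangent) (use P pr in auto)
    ultimately show ?thesis by (simp only:)
  qed
  have "(\<Sum>i\<in>UNIV. \<Sum>j\<in>UNIV. P i j * u i j)
      = (\<Sum>i\<in>UNIV. p $ i * (ln (\<phi> $ i) - ln (p $ i))) + (\<Sum>j\<in>UNIV. r j * ln (\<psi> $ j))
        - \<zeta> * (\<Sum>i\<in>UNIV. \<Sum>j\<in>UNIV. P i j * d i j)"
  proof -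
    have "(\<Sum>i\<in>UNIV. \<Sum>j\<in>UNIV. P i j * (ln (\<phi> $ i) - ln (p $ i)))
      = (\<Sum>i\<in>UNIV. p $ i * (ln (\<phi> $ i) - ln (p $ i)))"
      by (simp add: sum_distrib_right[symmetric] P)
    moreover have "(\<Sum>i\<in>UNIV. \<Sum>j\<in>UNIV. P i j * ln (\<psi> $ j)) = (\<Sum>j\<in>UNIV. r j * ln (\<psi> $ j))"
      by (subst sum.swap) (simp add: sum_distrib_right[symmetric] P)
    moreover have "P i j * u i j = P i j * (ln (\<phi> $ i) - ln (p $ i)) + P i j * ln (\<psi> $ j)
        - \<zeta> * (P i j * d i j)" for i j
      by (simp add: u_def algebra_simps)
    ultimately show ?thesis
      by (simp add: sum.distrib sum_subtractf sum_distrib_left[symmetric])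
  qed
  moreover have "\<zeta> * (\<Sum>i\<in>UNIV. \<Sum>j\<in>UNIV. P i j * d i j) \<le> \<zeta> * (\<Sum>i\<in>UNIV. \<Sum>j\<in>UNIV. p $ i * s i j * d i j)"
    using Pd \<zeta> by (rule mult_left_mono)
  moreover have "(\<Sum>i\<in>UNIV. \<Sum>j\<in>UNIV. p $ i * r j) = 1"
  proof -
    have "(\<Sum>j\<in>UNIV. r j) = (\<Sum>i\<in>UNIV. \<Sum>j\<in>UNIV. P i j)"
      by (subst sum.swap) (simp add: P)
    also have "\<dots> = 1" by (simp add: P p1)
    finally show ?thesis by (simp add: sum_distrib_left[symmetric] p1)
  qed
  moreover have "(\<Sum>i\<in>UNIV. \<Sum>j\<in>UNIV. P i j * u i j)
      - (\<Sum>i\<in>UNIV. \<Sum>j\<in>UNIV. \<phi> $ i * r j * \<psi> $ j * exp (- \<zeta> * d i j))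
      + (\<Sum>i\<in>UNIV. \<Sum>j\<in>UNIV. p $ i * r j) \<le> (\<Sum>i\<in>UNIV. \<Sum>j\<in>UNIV. gkl (P i j) (p $ i * r j))"
    unfolding sum.distrib[symmetric] sum_subtractf[symmetric] by (intro sum_mono le)
  ultimately show ?thesis
    unfolding program_objective_eq[OF \<phi>] r_def by linarith
qed

text \<open>Strong duality applied to the product of \<open>p\<close> and \<open>r\<close>. The
  resulting multipliers are converted into positive \<open>\<phi>\<close> and \<open>\<psi>\<close>
  and a nonnegative \<open>\<zeta>\<close>.\<close>

lemma program_objective_approaches_gkl:
  fixes s d :: "'m::finite \<Rightarrow> 'n::finite \<Rightarrow> real" and p :: "real ^ 'm"
  defines "r \<equiv> \<lambda>j. \<Sum>i\<in>UNIV. p $ i * s i j"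
  assumes p: "\<And>i. 0 \<le> p $ i" "(\<Sum>i\<in>UNIV. p $ i) = 1"
    and s: "\<And>i j. 0 \<le> s i j" "\<And>i. (\<Sum>j\<in>UNIV. s i j) = 1"
  obtains P where
    "\<And>i j. 0 \<le> P i j" "\<And>i. (\<Sum>j\<in>UNIV. P i j) = p $ i" "\<And>j. (\<Sum>i\<in>UNIV. P i j) = r j"
    "(\<Sum>i\<in>UNIV. \<Sum>j\<in>UNIV. P i j * d i j) \<le> (\<Sum>i\<in>UNIV. \<Sum>j\<in>UNIV. p $ i * s i j * d i j)"
    "\<And>e. 0 < e \<Longrightarrow> \<exists>\<phi> \<psi> \<zeta>. (\<forall>i. 0 < \<phi> $ i) \<and> (\<forall>j. 0 < \<psi> $ j) \<and> 0 \<le> \<zeta> \<and>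
      (\<Sum>i\<in>UNIV. \<Sum>j\<in>UNIV. gkl (P i j) (p $ i * r j)) - e \<le> program_objective s d p \<phi> \<psi> \<zeta>"
proof -
  define \<Delta> where "\<Delta> = (\<Sum>i\<in>UNIV. \<Sum>j\<in>UNIV. p $ i * s i j * d i j)"
  define Q where "Q z = p $ fst z * r (snd z)" for z
  \<comment> \<open>The three summands of the index type stand for the input marginals, the output
    marginals and the single metric inequality.\<close>
  define E :: "'m + 'n + unit \<Rightarrow> bool" where
    "E = case_sum (\<lambda>_. True) (case_sum (\<lambda>_. True) (\<lambda>_. False))"
  define A :: "'m + 'n + unit \<Rightarrow> 'm \<times> 'n \<Rightarrow> real" where
    "A k z = case_sum (\<lambda>i. if i = fst z then 1 else 0)
      (case_sum (\<lambda>j. if j = snd z then 1 else 0) (\<lambda>_. d (fst z) (snd z))) k" for k z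
  define c :: "'m + 'n + unit \<Rightarrow> real" where
    "c = case_sum (\<lambda>i. p $ i) (case_sum r (\<lambda>_. \<Delta>))"
  \<comment> \<open>The true joint law is the feasible starting point: it meets the metric
    constraint with equality, and \<open>p $ i * s i j \<le> r j\<close> makes it vanish wherever
    the product law does.\<close>
  define P0 :: "real ^ ('m \<times> 'n)" where "P0 = (\<chi> z. p $ fst z * s (fst z) (snd z))"
  have r0: "0 \<le> r j" for j unfolding r_def using p s by (intro sum_nonneg) simp
  have r1: "(\<Sum>j\<in>UNIV. r j) = 1"
    unfolding r_def by (subst sum.swap) (simp add: sum_distrib_left[symmetric] p s)
  have ps: "p $ i * s i j \<le> r j" for i j
    unfolding r_def by (rule member_le_sum[of i UNIV "\<lambda>i. p $ i * s i j"]) (use p s in auto)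
  have A1: "(\<Sum>z\<in>UNIV. A (Inl i) z * P $ z) = (\<Sum>j\<in>UNIV. P $ (i, j))" for P :: "real ^ ('m \<times> 'n)" and i
  proof -
    have "(\<Sum>z\<in>UNIV. A (Inl i) z * P $ z) = (\<Sum>i'\<in>UNIV. if i = i' then \<Sum>j\<in>UNIV. P $ (i', j) else 0)"
      unfolding sum_UNIV_prod by (intro sum.cong) (auto simp: A_def)
    then show ?thesis by simp
  qed
  have A2: "(\<Sum>z\<in>UNIV. A (Inr (Inl j)) z * P $ z) = (\<Sum>i\<in>UNIV. P $ (i, j))" for P :: "real ^ ('m \<times> 'n)" and j
  proof -
    have "(\<Sum>j'\<in>UNIV. A (Inr (Inl j)) (i, j') * P $ (i, j')) = (\<Sum>j'\<in>UNIV. if j = j' then P $ (i, j') else 0)" for i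
      by (intro sum.cong) (auto simp: A_def)
    then show ?thesis unfolding sum_UNIV_prod by simp
  qed
  have A3: "(\<Sum>z\<in>UNIV. A (Inr (Inr u)) z * P $ z) = (\<Sum>i\<in>UNIV. \<Sum>j\<in>UNIV. P $ (i, j) * d i j)"
    for P :: "real ^ ('m \<times> 'n)" and u
    unfolding sum_UNIV_prod by (simp add: A_def mult.commute)
  have res_iff: "(\<forall>k. residual (E k) ((\<Sum>z\<in>UNIV. A k z * P $ z) - c k) = 0) \<longleftrightarrow>
      (\<forall>i. (\<Sum>j\<in>UNIV. P $ (i, j)) = p $ i) \<and> (\<forall>j. (\<Sum>i\<in>UNIV. P $ (i, j)) = r j)
        \<and> (\<Sum>i\<in>UNIV. \<Sum>j\<in>UNIV. P $ (i, j) * d i j) \<le> \<Delta>" for P :: "real ^ ('m \<times> 'n)"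
    by (simp add: split_sum_all A1 A2 A3 E_def c_def residual_def max_def)
  have feas: "\<forall>k. residual (E k) ((\<Sum>z\<in>UNIV. A k z * P0 $ z) - c k) = 0"
    unfolding res_iff
    by (simp add: P0_def r_def \<Delta>_def sum_distrib_left[symmetric] s)
  have Q0: "0 \<le> Q z" for z using p r0 by (simp add: Q_def)
  have P00: "0 \<le> P0 $ z" for z using p s by (simp add: P0_def)
  have P0Q: "P0 $ z = 0" if "Q z = 0" for z
    using that ps[of "fst z" "snd z"] P00[of z] by (auto simp: Q_def P0_def)
  obtain P where P: "\<And>z. 0 \<le> P $ z" "\<And>z. Q z = 0 \<Longrightarrow> P $ z = 0"
    "\<And>k. residual (E k) ((\<Sum>z\<in>UNIV. A k z * P $ z) - c k) = 0"
    "\<And>e. 0 < e \<Longrightarrow> \<exists>l. (\<forall>k. \<not> E k \<longrightarrow> 0 \<le> l k) \<and>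
      (\<Sum>z\<in>UNIV. gkl (P $ z) (Q z)) - e
        \<le> (\<Sum>z\<in>UNIV. Q z - Q z * exp (- (\<Sum>k\<in>UNIV. l k * A k z))) - (\<Sum>k\<in>UNIV. l k * c k)"
    using entropy_strong_duality[where E = E and A = A and c = c and Q = Q, OF Q0 P00 P0Q spec[OF feas]] by blast
  have Q1: "(\<Sum>z\<in>UNIV. Q z) = 1"
    unfolding sum_UNIV_prod by (simp add: Q_def sum_distrib_left[symmetric] r1 p)
  show ?thesis
  proof (rule that[of "\<lambda>i j. P $ (i, j)"])
    fix e :: real assume e: "0 < e"
    \<comment> \<open>Half of \<open>e\<close> pays for the duality gap, the other half for making
      \<open>\<phi>\<close> positive.\<close>
    then have "0 < e / 2" by simp
    from P(4)[OF this] obtain l where l: "\<And>k. \<not> E k \<Longrightarrow> 0 \<le> l k"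
      and dual: "(\<Sum>z\<in>UNIV. gkl (P $ z) (Q z)) - e / 2
        \<le> (\<Sum>z\<in>UNIV. Q z - Q z * exp (- (\<Sum>k\<in>UNIV. l k * A k z))) - (\<Sum>k\<in>UNIV. l k * c k)"
      by blast
    \<comment> \<open>The dual function carries \<open>l\<close> with a minus sign in the exponent,
      hence the negations. The metric multiplier keeps its sign because it enters as
      \<open>- \<zeta> * d i j\<close>.\<close>
    define a where "a i = - l (Inl i)" for i
    define b where "b j = - l (Inr (Inl j))" for j
    define \<zeta> where "\<zeta> = l (Inr (Inr ()))"
    define \<psi> :: "real ^ 'n" where "\<psi> = (\<chi> j. exp (b j))"
    define C where "C = (\<Sum>i\<in>UNIV. \<Sum>j\<in>UNIV. r j * \<psi> $ j * exp (- \<zeta> * d i j))"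
    have C0: "0 \<le> C" unfolding C_def using r0 by (intro sum_nonneg) (simp add: \<psi>_def)
    \<comment> \<open>\<open>\<phi>\<close> must be positive even where \<open>p\<close> vanishes; there a small value \<open>\<eta>\<close> costs at most \<open>e / 2\<close>.\<close>
    define \<eta> where "\<eta> = e / (2 * (1 + C))"
    have \<eta>: "0 < \<eta>" "\<eta> * C \<le> e / 2" using e C0 by (auto simp: \<eta>_def field_simps)
    define \<phi> :: "real ^ 'm" where "\<phi> = (\<chi> i. if p $ i = 0 then \<eta> else p $ i * exp (a i))"
    have \<zeta>0: "0 \<le> \<zeta>" unfolding \<zeta>_def by (rule l) (simp add: E_def)
    have \<phi>0: "0 < \<phi> $ i" for i using \<eta> p(1)[of i] by (simp add: \<phi>_def less_le)
    have \<psi>0: "0 < \<psi> $ j" for j by (simp add: \<psi>_def)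
    have lA: "- (\<Sum>k\<in>UNIV. l k * A k (i, j)) = a i + b j - \<zeta> * d i j" for i j
      by (simp add: sum_UNIV_sum A_def a_def b_def \<zeta>_def UNIV_unit if_distrib[of "\<lambda>x. _ * x"] cong: if_cong)
    have lc: "(\<Sum>k\<in>UNIV. l k * c k) = - (\<Sum>i\<in>UNIV. p $ i * a i) - (\<Sum>j\<in>UNIV. r j * b j) + \<zeta> * \<Delta>"
      by (simp add: sum_UNIV_sum c_def a_def b_def \<zeta>_def UNIV_unit sum_negf mult.commute)
    have "\<phi> $ i * r j * \<psi> $ j * exp (- \<zeta> * d i j)
        \<le> Q (i, j) * exp (a i + b j - \<zeta> * d i j) + \<eta> * (r j * \<psi> $ j * exp (- \<zeta> * d i j))" for i j
    proof -
      have "Q (i, j) * exp (a i + b j - \<zeta> * d i j) = p $ i * exp (a i) * (r j * \<psi> $ j * exp (- \<zeta> * d i j))"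
        by (simp add: Q_def \<psi>_def exp_add[symmetric] mult_ac)
      moreover have "\<phi> $ i \<le> p $ i * exp (a i) + \<eta>"
        using \<eta> by (simp add: \<phi>_def)
      then have "\<phi> $ i * (r j * \<psi> $ j * exp (- \<zeta> * d i j))
          \<le> (p $ i * exp (a i) + \<eta>) * (r j * \<psi> $ j * exp (- \<zeta> * d i j))"
        using r0[of j] \<psi>0[of j] by (intro mult_right_mono) auto
      ultimately show ?thesis by (simp add: distrib_right mult.assoc)
    qed
    then have "(\<Sum>i\<in>UNIV. \<Sum>j\<in>UNIV. \<phi> $ i * r j * \<psi> $ j * exp (- \<zeta> * d i j))
        \<le> (\<Sum>i\<in>UNIV. \<Sum>j\<in>UNIV. Q (i, j) * exp (a i + b j - \<zeta> * d i j)
            + \<eta> * (r j * \<psi> $ j * exp (- \<zeta> * d i j)))"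
      by (intro sum_mono)
    also have "\<dots> = (\<Sum>i\<in>UNIV. \<Sum>j\<in>UNIV. Q (i, j) * exp (a i + b j - \<zeta> * d i j)) + \<eta> * C"
      by (simp add: sum.distrib C_def sum_distrib_left)
    finally have Sle: "(\<Sum>i\<in>UNIV. \<Sum>j\<in>UNIV. \<phi> $ i * r j * \<psi> $ j * exp (- \<zeta> * d i j))
        \<le> (\<Sum>i\<in>UNIV. \<Sum>j\<in>UNIV. Q (i, j) * exp (a i + b j - \<zeta> * d i j)) + e / 2"
      using \<eta>(2) by linarith
    \<comment> \<open>Where \<open>p $ i = 0\<close> both sides vanish, so the value
      \<open>\<eta>\<close> affects the exponential double sum only.\<close>
    have "p $ i * (ln (\<phi> $ i) - ln (p $ i)) = p $ i * a i" for i
      using p(1)[of i] by (simp add: \<phi>_def ln_mult)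
    then have "program_objective s d p \<phi> \<psi> \<zeta> = (\<Sum>i\<in>UNIV. p $ i * a i) + (\<Sum>j\<in>UNIV. r j * b j) - \<zeta> * \<Delta>
        - (\<Sum>i\<in>UNIV. \<Sum>j\<in>UNIV. \<phi> $ i * r j * \<psi> $ j * exp (- \<zeta> * d i j)) + 1"
      unfolding program_objective_eq[OF \<phi>0] \<Delta>_def r_def by (simp only: \<psi>_def vec_lambda_beta ln_exp)
    moreover have "(\<Sum>z\<in>UNIV. Q z - Q z * exp (- (\<Sum>k\<in>UNIV. l k * A k z)))
        = 1 - (\<Sum>i\<in>UNIV. \<Sum>j\<in>UNIV. Q (i, j) * exp (a i + b j - \<zeta> * d i j))"
      by (simp only: sum_subtractf Q1) (simp only: sum_UNIV_prod lA)
    moreover have "(\<Sum>z\<in>UNIV. gkl (P $ z) (Q z)) = (\<Sum>i\<in>UNIV. \<Sum>j\<in>UNIV. gkl (P $ (i, j)) (p $ i * r j))"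
      by (simp add: sum_UNIV_prod Q_def)
    ultimately have "(\<Sum>i\<in>UNIV. \<Sum>j\<in>UNIV. gkl (P $ (i, j)) (p $ i * r j)) - e \<le> program_objective s d p \<phi> \<psi> \<zeta>"
      using dual lc Sle by linarith
    then show "\<exists>\<phi> \<psi> \<zeta>. (\<forall>i. 0 < \<phi> $ i) \<and> (\<forall>j. 0 < \<psi> $ j) \<and> 0 \<le> \<zeta> \<and>
      (\<Sum>i\<in>UNIV. \<Sum>j\<in>UNIV. gkl (P $ (i, j)) (p $ i * r j)) - e \<le> program_objective s d p \<phi> \<psi> \<zeta>"
      using \<phi>0 \<psi>0 \<zeta>0 by blast
  qed (use P(1,3) res_iff[of P] in \<open>auto simp: \<Delta>_def\<close>)
qed

section \<open>Transfer to the LM rate and its optimum over input laws\<close>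

lemma sum_range_Times:
  fixes f :: "'a \<times> 'b \<Rightarrow> real" and x :: "'m::finite \<Rightarrow> 'a" and y :: "'n::finite \<Rightarrow> 'b"
  assumes "inj x" "inj y"
  shows "(\<Sum>z\<in>range x \<times> range y. f z) = (\<Sum>i\<in>UNIV. \<Sum>j\<in>UNIV. f (x i, y j))"
  unfolding sum.cartesian_product'
  by (simp add: sum.reindex assms)

theorem proposition2:
  fixes x :: "'m::finite \<Rightarrow> 'a::euclidean_space"
    and y :: "'n::finite \<Rightarrow> 'b"
    and X :: "'a set" and Y :: "'b set"
    and W q :: "'a \<Rightarrow> 'b \<Rightarrow> real"
    and s d :: "'m \<Rightarrow> 'n \<Rightarrow> real"
    and \<Gamma> :: real
  assumes "inj x" and "X = range x"
    and "inj y" and "Y = range y"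
    and "channel X Y W"
    and "\<forall>u\<in>X. \<forall>v\<in>Y. 0 < q u v"
    and "\<And>i j. s i j = W (x i) (y j)"
    and "\<And>i j. d i j = - ln (q (x i) (y j))"
  shows "C_LM X Y W q \<Gamma> =
    (SUP (p, \<phi>, \<psi>, \<zeta>)\<in>program_feasible x \<Gamma>. ereal (program_objective s d p \<phi> \<psi> \<zeta>))"
proof -
  note X = assms(2) and Y = assms(4) and inj = assms(1,3) and s = assms(7) and d = assms(8)
  define r where "r p j = (\<Sum>i\<in>UNIV. p $ i * s i j)" for p :: "real ^ 'm" and j
  have sumX: "(\<Sum>u\<in>X. f u) = (\<Sum>i\<in>UNIV. f (x i))" for f :: "'a \<Rightarrow> real"
    by (simp add: X sum.reindex inj)
  have sumY: "(\<Sum>v\<in>Y. f v) = (\<Sum>j\<in>UNIV. f (y j))" for f :: "'b \<Rightarrow> real"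
    by (simp add: Y sum.reindex inj)
  have sumXY: "(\<Sum>z\<in>X \<times> Y. f z) = (\<Sum>i\<in>UNIV. \<Sum>j\<in>UNIV. f (x i, y j))" for f :: "'a \<times> 'b \<Rightarrow> real"
    unfolding X Y by (rule sum_range_Times[OF inj])
  have s_dist: "0 \<le> s i j" "(\<Sum>j\<in>UNIV. s i j) = 1" for i j
    using assms(5) sumY[of "W (x i)"] by (auto simp: channel_def prob_dist_def X s) (auto simp: Y)
  \<comment> \<open>Passing to indices, \<open>ln q = - d\<close> turns the lower bound on the
    expected log metric into an upper bound on the expected \<open>d\<close>.\<close>
  have LM_feasible_iff: "P \<in> LM_feasible X Y W q Q \<longleftrightarrow>
      prob_dist (X \<times> Y) P \<and> (\<forall>i. (\<Sum>j\<in>UNIV. P (x i, y j)) = p $ i)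
      \<and> (\<forall>j. (\<Sum>i\<in>UNIV. P (x i, y j)) = r p j)
      \<and> (\<Sum>i\<in>UNIV. \<Sum>j\<in>UNIV. P (x i, y j) * d i j) \<le> (\<Sum>i\<in>UNIV. \<Sum>j\<in>UNIV. p $ i * s i j * d i j)"
    if "\<And>i. Q (x i) = p $ i" for P Q and p :: "real ^ 'm"
  proof -
    have "joint_law W Q (x i, y j) = p $ i * s i j" for i j
      by (simp add: joint_law_def that s)
    moreover have "ln (q (x i) (y j)) = - d i j" for i j by (simp add: d)
    ultimately show ?thesis
      unfolding LM_feasible_def expected_log_metric_def sumXY marginal1_def marginal2_def sumX sumY
      by (simp add: X Y that r_def sum_negf)
  qed
  \<comment> \<open>The coupling and the product of its marginals both have mass 1, so the linear
    parts of \<open>gkl\<close> cancel in the sum and leave the mutual information.\<close>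
  have mutual_info_gkl: "mutual_info X Y P = (\<Sum>i\<in>UNIV. \<Sum>j\<in>UNIV. gkl (P (x i, y j)) (p $ i * r p j))"
    if "P \<in> LM_feasible X Y W q Q" "\<And>i. Q (x i) = p $ i" for P Q and p :: "real ^ 'm"
  proof -
    have P: "prob_dist (X \<times> Y) P" "\<And>i. (\<Sum>j\<in>UNIV. P (x i, y j)) = p $ i" "\<And>j. (\<Sum>i\<in>UNIV. P (x i, y j)) = r p j"
      using that(1) unfolding LM_feasible_iff[OF that(2)] by auto
    have p1: "(\<Sum>i\<in>UNIV. p $ i) = 1"
      using P(1) by (simp add: prob_dist_def sumXY P(2))
    have "(\<Sum>j\<in>UNIV. r p j) = 1"
      unfolding r_def by (subst sum.swap) (simp add: sum_distrib_left[symmetric] s_dist p1)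
    then have pr1: "(\<Sum>i\<in>UNIV. \<Sum>j\<in>UNIV. p $ i * r p j) = 1"
      by (simp add: sum_distrib_left[symmetric] p1)
    have "finite X" "finite Y" by (auto simp: X Y)
    then have "mutual_info X Y P
        = (\<Sum>i\<in>UNIV. \<Sum>j\<in>UNIV. P (x i, y j) * ln (P (x i, y j) / (p $ i * r p j)))"
      using P by (simp add: mutual_info_eq_sum sumXY marginal1_def marginal2_def sumX sumY)
    then show ?thesis
      by (simp add: gkl_def sum.distrib sum_subtractf P(2) p1 pr1)
  qed
  show ?thesis
  proof (rule antisym)
    show "C_LM X Y W q \<Gamma> \<le>
      (SUP (p, \<phi>, \<psi>, \<zeta>)\<in>program_feasible x \<Gamma>. ereal (program_objective s d p \<phi> \<psi> \<zeta>))" (is "_ \<le> ?S")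
      unfolding C_LM_def
    proof (rule SUP_least)
      fix Q assume Q: "Q \<in> {Q. prob_dist X Q \<and> (\<Sum>x\<in>X. Q x * (norm x)\<^sup>2) \<le> \<Gamma>}"
      define p :: "real ^ 'm" where "p = (\<chi> i. Q (x i))"
      have Qp: "Q (x i) = p $ i" for i by (simp add: p_def)
      have p: "\<And>i. 0 \<le> p $ i" "(\<Sum>i\<in>UNIV. p $ i) = 1" "(\<Sum>i\<in>UNIV. p $ i * (norm (x i))\<^sup>2) \<le> \<Gamma>"
        using Q by (auto simp: prob_dist_def sumX Qp) (simp add: X Qp[symmetric])
      obtain P where P: "\<And>i j. 0 \<le> P i j" "\<And>i. (\<Sum>j\<in>UNIV. P i j) = p $ i" "\<And>j. (\<Sum>i\<in>UNIV. P i j) = r p j"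
          "(\<Sum>i\<in>UNIV. \<Sum>j\<in>UNIV. P i j * d i j) \<le> (\<Sum>i\<in>UNIV. \<Sum>j\<in>UNIV. p $ i * s i j * d i j)"
        and dual: "\<And>e. 0 < e \<Longrightarrow> \<exists>\<phi> \<psi> \<zeta>. (\<forall>i. 0 < \<phi> $ i) \<and> (\<forall>j. 0 < \<psi> $ j) \<and> 0 \<le> \<zeta> \<and>
          (\<Sum>i\<in>UNIV. \<Sum>j\<in>UNIV. gkl (P i j) (p $ i * r p j)) - e \<le> program_objective s d p \<phi> \<psi> \<zeta>"
        unfolding r_def
        by (rule program_objective_approaches_gkl[where s = s and d = d, OF p(1,2) s_dist]) blast
      \<comment> \<open>The coupling on indices is carried back to the alphabets through the
        inverses of the two enumerations.\<close>
      define P' where "P' z = P (inv x (fst z)) (inv y (snd z))" for z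
      have P'[simp]: "P' (x i, y j) = P i j" for i j by (simp add: P'_def inj)
      have P'f: "P' \<in> LM_feasible X Y W q Q"
        unfolding LM_feasible_iff[OF Qp] prob_dist_def sumXY P' using P p
        by (auto simp: X Y)
      have "LM_rate X Y W q Q \<le> ereal (mutual_info X Y P')"
        unfolding LM_rate_def using P'f by (rule INF_lower)
      \<comment> \<open>The dual supremum need not be attained, so the comparison is made up to
        every \<open>e\<close> with the same coupling.\<close>
      also have "\<dots> \<le> ?S"
      proof (rule ereal_le_epsilon2)
        fix e :: real assume "0 < e"
        from dual[OF this] obtain \<phi> \<psi> \<zeta> where D: "\<And>i. 0 < \<phi> $ i" "\<And>j. 0 < \<psi> $ j" "0 \<le> \<zeta>"
          "(\<Sum>i\<in>UNIV. \<Sum>j\<in>UNIV. gkl (P i j) (p $ i * r p j)) - e \<le> program_objective s d p \<phi> \<psi> \<zeta>"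
          by blast
        have "(p, \<phi>, \<psi>, \<zeta>) \<in> program_feasible x \<Gamma>"
          using D p by (simp add: program_feasible_def)
        then have "ereal (program_objective s d p \<phi> \<psi> \<zeta>) \<le> ?S"
          by (rule SUP_upper2) simp
        moreover have "ereal (mutual_info X Y P') \<le> ereal (program_objective s d p \<phi> \<psi> \<zeta>) + ereal e"
          using D(4) by (simp add: mutual_info_gkl[OF P'f Qp])
        ultimately show "ereal (mutual_info X Y P') \<le> ?S + ereal e"
          by (meson add_right_mono order.trans)
      qed
      finally show "LM_rate X Y W q Q \<le> ?S" .
    qed
  next
    show "(SUP (p, \<phi>, \<psi>, \<zeta>)\<in>program_feasible x \<Gamma>. ereal (program_objective s d p \<phi> \<psi> \<zeta>)) \<le> C_LM X Y W q \<Gamma>"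
    proof (rule SUP_least, clarify)
      fix p :: "real ^ 'm" and \<phi> :: "real ^ 'm" and \<psi> :: "real ^ 'n" and \<zeta> :: real
      assume "(p, \<phi>, \<psi>, \<zeta>) \<in> program_feasible x \<Gamma>"
      then have p: "\<And>i. 0 \<le> p $ i" "(\<Sum>i\<in>UNIV. p $ i) = 1" "(\<Sum>i\<in>UNIV. p $ i * (norm (x i))\<^sup>2) \<le> \<Gamma>"
        and D: "\<And>i. 0 < \<phi> $ i" "\<And>j. 0 < \<psi> $ j" "0 \<le> \<zeta>"
        by (auto simp: program_feasible_def)
      define Q where "Q u = p $ inv x u" for u
      have Qp: "Q (x i) = p $ i" for i by (simp add: Q_def inj)
      \<comment> \<open>Weak duality puts the objective below the mutual information of every
        feasible coupling, hence below their infimum.\<close>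
      have "ereal (program_objective s d p \<phi> \<psi> \<zeta>) \<le> LM_rate X Y W q Q"
        unfolding LM_rate_def
      proof (rule INF_greatest)
        fix P assume P: "P \<in> LM_feasible X Y W q Q"
        have "program_objective s d p \<phi> \<psi> \<zeta>
            \<le> (\<Sum>i\<in>UNIV. \<Sum>j\<in>UNIV. gkl (P (x i, y j)) (p $ i * (\<Sum>i\<in>UNIV. p $ i * s i j)))"
          using P unfolding LM_feasible_iff[OF Qp] prob_dist_def r_def
          by (intro program_objective_le_gkl p D) (auto simp: X Y)
        then show "ereal (program_objective s d p \<phi> \<psi> \<zeta>) \<le> ereal (mutual_info X Y P)"
          by (simp add: mutual_info_gkl[OF P Qp] r_def)
      qed
      also have "\<dots> \<le> C_LM X Y W q \<Gamma>"
      proof -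
        have "\<forall>u\<in>X. 0 \<le> Q u" using p(1) by (simp add: X Qp)
        then show ?thesis
          unfolding C_LM_def using p by (intro SUP_upper) (simp add: prob_dist_def sumX Qp)
      qed
      finally show "ereal (program_objective s d p \<phi> \<psi> \<zeta>) \<le> C_LM X Y W q \<Gamma>" .
    qed
  qed
qed

end
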